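(* Let $\mathbb{T}$ be the circle. Any Denjoy system $(\mathbb{T},T)$ is diam-mean equicontinuous.
   Context: A Denjoy system $(\mathbb{T},T)$ is an orientation preserving homeomorphism $T\colon\mathbb{T}\to\mathbb{T}$ of the circle that is not minimal and has no periodic points. Let $d$ be a metric on $\mathbb{T}$ inducing its topology (e.g. the arc-length metric), $B_\delta(x)=\{x'\in\mathbb{T}: d(x,x')\le\delta\}$ and $\operatorname{diam}(A)=\sup_{x,x'\in A}d(x,x')$. A system $(\mathbb{T},T)$ is diam-mean equicontinuous if for all $\epsilon>0$ there is $\delta>0$ such that for all $x\in \mathbb{T}$ we have $\limsup_{n\to\infty}\frac1n\sum_{k=0}^{n-1}\operatorname{diam}(T^k(B_\delta(x)))<\epsilon$. *)

theory Defs
  imports "HOL-Analysis.Analysis"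
begin

abbreviation circle :: "complex set" where
  "circle \<equiv> sphere 0 1"

text \<open>
  A circle homeomorphism preserves orientation iff it has an increasing continuous lift
  through the universal covering \<open>x \<mapsto> cis (2 * pi * x)\<close> of the circle. The degree condition
  \<open>F (x + 1) = F x + 1\<close> then follows from injectivity.
\<close>
definition orientation_preserving_homeo :: "(complex \<Rightarrow> complex) \<Rightarrow> bool" where
  "orientation_preserving_homeo T \<longleftrightarrow>
     homeomorphic_map (top_of_set circle) (top_of_set circle) T \<and>
     (\<exists>F :: real \<Rightarrow> real. continuous_on UNIV F \<and> strict_mono F \<and>
        (\<forall>x. T (cis (2 * pi * x)) = cis (2 * pi * F x)))"

definition minimal_map :: "'a topology \<Rightarrow> ('a \<Rightarrow> 'a) \<Rightarrow> bool" where
  "minimal_map X T \<longleftrightarrow>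
     (\<forall>A. closedin X A \<and> T ` A \<subseteq> A \<longrightarrow> A = {} \<or> A = topspace X)"

definition periodic_point :: "('a \<Rightarrow> 'a) \<Rightarrow> 'a \<Rightarrow> bool" where
  "periodic_point T x \<longleftrightarrow> (\<exists>n::nat. n \<ge> 1 \<and> (T ^^ n) x = x)"

definition Denjoy_system :: "(complex \<Rightarrow> complex) \<Rightarrow> bool" where
  "Denjoy_system T \<longleftrightarrow>
     orientation_preserving_homeo T \<and>
     \<not> minimal_map (top_of_set circle) T \<and>
     (\<forall>x\<in>circle. \<not> periodic_point T x)"

text \<open>
  The supremum is taken in the reals, so it is meaningful only for nonempty sets that are
  bounded for \<open>d\<close>; on a compact metric space every nonempty set qualifies.
\<close>
definition mdiam :: "('a \<Rightarrow> 'a \<Rightarrow> real) \<Rightarrow> 'a set \<Rightarrow> real" where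
  "mdiam d A = (SUP (x, x') \<in> A \<times> A. d x x')"

definition diam_mean_equicontinuous ::
    "'a set \<Rightarrow> ('a \<Rightarrow> 'a \<Rightarrow> real) \<Rightarrow> ('a \<Rightarrow> 'a) \<Rightarrow> bool" where
  "diam_mean_equicontinuous M d T \<longleftrightarrow>
     (\<forall>\<epsilon>>0. \<exists>\<delta>>0. \<forall>x\<in>M.
        limsup (\<lambda>n. ereal (1 / real n *
          (\<Sum>k<n. mdiam d ((T ^^ k) ` Metric_space.mcball M d x \<delta>)))) < ereal \<epsilon>)"

end

theory Submission
  imports Defs
begin

text \<open>
  The absence of periodic points forces long return times to short arcs, and an arc whose iterates
  are often large would have to return too often.

  Fix \<open>\<epsilon>\<close> and cut the circle at a finite set \<open>F\<close> into arcs of diameter at most \<open>\<epsilon> / 2\<close>.  The image \<open>(T ^^ k) ` J\<close> of an arc \<open>J\<close> is connected, so if its diameter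
  exceeds \<open>\<epsilon> / 2\<close> then it contains a point of \<open>F\<close> (\<open>fine_cut\<close>).  It is therefore enough to bound,
  for each \<open>p \<in> F\<close>, the frequency of the times \<open>k\<close> at which \<open>p \<in> (T ^^ k) ` J\<close>.

  By compactness and the absence of periodic points, every point is moved by at least some
  \<open>c > 0\<close> under each of the first \<open>L - 1\<close> iterates (\<open>iterates_displace\<close>).  Hence an arc \<open>J\<close> of
  diameter less than \<open>c\<close> is disjoint from its image under each of these iterates, and by injectivity
  two times \<open>k\<close> with \<open>p \<in> (T ^^ k) ` J\<close> differ by at least \<open>L\<close> (\<open>visits_separated\<close>).  Their
  frequency is at most \<open>1 / L\<close>, uniformly in \<open>J\<close> and \<open>p\<close>.  As \<open>F\<close> is fixed before \<open>L\<close>, taking \<open>L\<close>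
  large makes the contribution of the times with large diameter as small as desired.

  Working with arcs instead of balls costs nothing: small balls of \<open>d\<close> lie in short arcs
  (\<open>mcball_subset_arc\<close>), and the diameter is monotone.
\<close>

section \<open>Arcs of the circle\<close>

abbreviation wrap :: "real \<Rightarrow> complex" where
  "wrap t \<equiv> cis (2 * pi * t)"

abbreviation arc_around :: "real \<Rightarrow> real \<Rightarrow> complex set" where
  "arc_around t r \<equiv> wrap ` {t - r..t + r}"

lemma continuous_on_wrap: "continuous_on S wrap"
  by (intro continuous_intros)

lemma wrap_eq_iff: "wrap s = wrap t \<longleftrightarrow> s - t \<in> \<int>"
proof -
  have "wrap s = wrap t \<longleftrightarrow> (\<exists>n::int. 2 * pi * s = 2 * pi * t + 2 * pi * n)"
    by (simp add: complex_eq_iff conj_commute flip: sin_cos_eq_iff)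
  also have "\<dots> \<longleftrightarrow> (\<exists>n::int. s = t + n)"
  proof -
    have "2 * pi * s = 2 * pi * t + 2 * pi * n \<longleftrightarrow> s = t + n" for n
      by (metis distrib_left mult_cancel_left pi_neq_zero mult_eq_0_iff zero_neq_numeral)
    then show ?thesis by simp
  qed
  also have "\<dots> \<longleftrightarrow> s - t \<in> \<int>"
    by (auto simp: Ints_def algebra_simps)
  finally show ?thesis .
qed

lemma circle_wrapE:
  assumes "x \<in> circle"
  obtains t where "a \<le> t" "t < a + 1" "x = wrap t"
proof -
  obtain u where u: "x = cis u"
    using assms by (metis cis_conv_exp complex_norm_eq_1_exp mem_sphere_0)
  define s where "s = u / (2 * pi)"
  have s: "x = wrap s" using u by (simp add: s_def)
  show ?thesis
  proof (rule that[of "a + frac (s - a)"])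
    show "x = wrap (a + frac (s - a))"
      unfolding s wrap_eq_iff by (simp add: frac_def)
  qed (auto simp: frac_lt_1)
qed

lemma compact_wrap_image: "compact (wrap ` {a..b})"
  by (intro compact_continuous_image continuous_on_wrap) simp

lemma connected_subset_arc:
  assumes "connected C" "C \<subseteq> circle" "a \<le> b" "b \<le> a + 1"
    and ends: "wrap a \<notin> C" "wrap b \<notin> C" and meets: "wrap ` {a..b} \<inter> C \<noteq> {}"
  shows "C \<subseteq> wrap ` {a..b}"
proof -
  \<comment> \<open>The arc and its complementary closed arc meet only at the two end points.\<close>
  define A B where "A = wrap ` {a..b}" and "B = wrap ` {b..a + 1}"
  have cover: "C \<subseteq> A \<union> B"
  proof
    fix x assume "x \<in> C"
    then obtain t where "a \<le> t" "t < a + 1" "x = wrap t"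
      using assms circle_wrapE by (metis subsetD)
    then show "x \<in> A \<union> B" by (cases "t \<le> b") (auto simp: A_def B_def)
  qed
  have "A \<inter> B \<subseteq> {wrap a, wrap b}"
  proof
    fix x assume "x \<in> A \<inter> B"
    then obtain s u where "x = wrap s" "s \<in> {a..b}" "x = wrap u" "u \<in> {b..a + 1}"
      unfolding A_def B_def by blast
    then have su: "x = wrap s" "a \<le> s" "s \<le> b" "x = wrap u" "b \<le> u" "u \<le> a + 1"
      by auto
    then have "u - s \<in> \<int>" by (metis wrap_eq_iff)
    then obtain n where n: "u - s = of_int n" by (auto elim: Ints_cases)
    have "0 \<le> n" "n \<le> 1" using su n by linarith+
    then have "n = 0 \<or> n = 1" by auto
    then have "s = a \<or> s = b" using n su by auto
    then show "x \<in> {wrap a, wrap b}" using su(1) by blast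
  qed
  then have "A \<inter> B \<inter> C = {}" using ends by blast
  moreover have "closed A" "closed B"
    unfolding A_def B_def by (intro compact_imp_closed compact_wrap_image)+
  ultimately have "A \<inter> C = {} \<or> B \<inter> C = {}"
    using connected_closedD[OF assms(1) _ cover] by blast
  then show ?thesis using meets cover unfolding A_def[symmetric] by blast
qed

section \<open>Metrics compatible with the topology of the circle\<close>

locale circle_metric = Metric_space circle d for d :: "complex \<Rightarrow> complex \<Rightarrow> real" +
  assumes mtopology_circle: "mtopology = top_of_set circle"
begin

lemma continuous_on_d:
  fixes f g :: "'a::topological_space \<Rightarrow> complex"
  assumes "continuous_on S f" "f ` S \<subseteq> circle" "continuous_on S g" "g ` S \<subseteq> circle"
  shows "continuous_on S (\<lambda>x. d (f x) (g x))"
proof -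
  have "continuous_map (top_of_set S) (mtopology_of (metric (circle, d))) h"
    if "continuous_on S h" "h ` S \<subseteq> circle" for h
    using that mtopology_circle by (auto simp: mtopology_of continuous_map_in_subtopology)
  from continuous_map_mdist[OF this[OF assms(1,2)] this[OF assms(3,4)]]
  show ?thesis by simp
qed

lemma d_bounded: obtains M where "M > 0" "\<And>x y. x \<in> circle \<Longrightarrow> y \<in> circle \<Longrightarrow> d x y \<le> M"
proof -
  have "continuous_on (circle \<times> circle) (\<lambda>z. d (fst z) (snd z))"
    by (intro continuous_on_d continuous_intros) auto
  then have "bounded ((\<lambda>z. d (fst z) (snd z)) ` (circle \<times> circle))"
    by (intro compact_imp_bounded compact_continuous_image compact_Times) auto
  then obtain M where "M > 0" "\<forall>z\<in>circle \<times> circle. norm (d (fst z) (snd z)) \<le> M"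
    unfolding bounded_pos by auto
  then show ?thesis by (intro that[of M]) force+
qed

lemma wrap_uniformly_continuous:
  assumes "\<epsilon> > 0"
  obtains r where "r > 0" "\<And>s t. \<bar>s - t\<bar> \<le> r \<Longrightarrow> d (wrap s) (wrap t) < \<epsilon>"
proof -
  \<comment> \<open>By periodicity \<open>t\<close> may be taken in the unit interval and \<open>s\<close> within distance 1 of it.\<close>
  let ?K = "{0..1::real} \<times> {-1..2::real}"
  let ?D = "\<lambda>z. d (wrap (fst z)) (wrap (snd z))"
  have "uniformly_continuous_on ?K ?D"
    by (intro compact_uniformly_continuous continuous_on_d continuous_intros compact_Times) auto
  then obtain r where r: "r > 0"
    "\<And>z z'. z \<in> ?K \<Longrightarrow> z' \<in> ?K \<Longrightarrow> dist z' z < r \<Longrightarrow> dist (?D z') (?D z) < \<epsilon>"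
    using assms unfolding uniformly_continuous_on_def by metis
  show ?thesis
  proof (rule that[of "min (r / 2) 1"])
    fix s t :: real assume st: "\<bar>s - t\<bar> \<le> min (r / 2) 1"
    define t' s' where "t' = frac t" and "s' = s - of_int \<lfloor>t\<rfloor>"
    have "0 \<le> t'" "t' < 1" by (auto simp: t'_def frac_lt_1)
    moreover have diff: "s' - t' = s - t" by (simp add: t'_def s'_def frac_def)
    ultimately have "(t', s') \<in> ?K" "(t', t') \<in> ?K" "dist (t', s') (t', t') < r"
      using st r(1) by (auto simp: dist_Pair_Pair dist_real_def)
    from r(2)[OF this(2,1,3)] have "d (wrap t') (wrap s') < \<epsilon>"
      by (simp add: dist_real_def)
    moreover have "wrap t' = wrap t" "wrap s' = wrap s"
      by (simp_all add: wrap_eq_iff t'_def s'_def frac_def)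
    ultimately show "d (wrap s) (wrap t) < \<epsilon>" by (simp add: commute)
  qed (use r in auto)
qed

lemma mcball_subset_arc:
  assumes "r > 0"
  obtains \<delta> where "\<delta> > 0" "\<And>t. mcball (wrap t) \<delta> \<subseteq> arc_around t r"
proof -
  \<comment> \<open>For \<open>(t, h)\<close> in the compact set \<open>?K\<close> the shift \<open>h\<close> is not an integer, so the points at \<open>t\<close> and
    \<open>t + h\<close> are distinct, and by compactness their distance has a positive minimum.
    The point \<open>1/2\<close> keeps \<open>?K\<close> nonempty when \<open>r\<close> is large.\<close>
  let ?H = "{-1/2..1/2::real} - {-r<..<r} \<union> {1/2}"
  let ?K = "{0..1::real} \<times> ?H"
  let ?D = "\<lambda>z. d (wrap (fst z)) (wrap (fst z + snd z))"
  have "compact ?K"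
    by (intro compact_Times compact_Un compact_diff) auto
  moreover have "continuous_on ?K ?D"
    by (intro continuous_on_d continuous_intros) auto
  moreover have "?K \<noteq> {}" by auto
  ultimately obtain z where z: "z \<in> ?K" "\<And>y. y \<in> ?K \<Longrightarrow> ?D z \<le> ?D y"
    using continuous_attains_inf[of ?K ?D] by blast
  have "snd z \<notin> \<int>"
  proof
    assume "snd z \<in> \<int>"
    then obtain n where n: "snd z = of_int n" by (auto elim: Ints_cases)
    have "snd z \<noteq> 0" "- 1 < snd z" "snd z < 1" using z(1) assms by auto
    then show False using n by auto
  qed
  then have "wrap (fst z) \<noteq> wrap (fst z + snd z)"
    by (simp add: wrap_eq_iff)
  then have pos: "?D z > 0"
    by (simp add: mdist_pos_less)
  show ?thesis
  proof (rule that[of "?D z / 2"])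
    fix t show "mcball (wrap t) (?D z / 2) \<subseteq> arc_around t r"
    proof
      fix y assume y: "y \<in> mcball (wrap t) (?D z / 2)"
      then obtain s where s: "t - 1/2 \<le> s" "s < t - 1/2 + 1" "y = wrap s"
        using circle_wrapE[of y "t - 1/2"] by (auto simp: in_mcball)
      have "\<bar>s - t\<bar> < r"
      proof (rule ccontr)
        assume "\<not> \<bar>s - t\<bar> < r"
        then have "(frac t, s - t) \<in> ?K"
          using s frac_lt_1[of t] by (auto intro: less_imp_le)
        from z(2)[OF this] have "?D z \<le> d (wrap (frac t)) (wrap (frac t + (s - t)))" by simp
        moreover have "wrap (frac t) = wrap t" "wrap (frac t + (s - t)) = y"
          unfolding s wrap_eq_iff by (auto simp: frac_def)
        ultimately show False using y pos by (auto simp: in_mcball)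
      qed
      then have "s \<in> {t - r..t + r}" by auto
      then show "y \<in> arc_around t r" using s(3) by blast
    qed
  qed (use pos in auto)
qed

text \<open>
  The cut points divide the circle into arcs of parameter length \<open>1 / m\<close>.  A connected set that
  avoids them stays inside one of these arcs, which is small by uniform continuity.
\<close>
lemma fine_cut:
  assumes "\<epsilon> > 0"
  obtains F where "finite F"
    "\<And>C x y. \<lbrakk>connected C; C \<subseteq> circle; C \<inter> F = {}; x \<in> C; y \<in> C\<rbrakk> \<Longrightarrow> d x y \<le> \<epsilon>"
proof -
  obtain r where r: "r > 0" "\<And>s t. \<bar>s - t\<bar> \<le> r \<Longrightarrow> d (wrap s) (wrap t) < \<epsilon>"
    using wrap_uniformly_continuous[OF assms] by metis
  obtain m :: nat where m: "m > 0" "1 / m < r"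
    using r(1) by (metis nat_approx_posE zero_less_Suc)
  define F where "F = (\<lambda>i. wrap (real i / m)) ` {..m}"
  show ?thesis
  proof (rule that[of F])
    fix C x y assume C: "connected C" "C \<subseteq> circle" "C \<inter> F = {}" and xy: "x \<in> C" "y \<in> C"
    obtain t where t: "0 \<le> t" "t < 1" "x = wrap t"
      using C xy circle_wrapE[of x 0] by (metis add.left_neutral subsetD)
    define i where "i = nat \<lfloor>t * m\<rfloor>"
    have i: "real i \<le> t * m" "t * m < real i + 1"
      using t by (simp_all add: i_def)
    have "t * m < m" using t m by simp
    then have im: "i < m" using i by linarith
    let ?a = "real i / m" and ?b = "real (Suc i) / m"
    have ab: "?a \<le> t" "t \<le> ?b" "?b = ?a + 1 / m" "1 / m \<le> (1::real)"
      using i m by (auto simp: field_simps)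
    have "wrap ?a \<in> F" "wrap ?b \<in> F" using im unfolding F_def
      by (auto intro: image_eqI[of _ _ i] image_eqI[of _ _ "Suc i"] simp del: of_nat_Suc)
    then have "wrap ?a \<notin> C" "wrap ?b \<notin> C" using C(3) by blast+
    moreover have "x \<in> wrap ` {?a..?b}" unfolding t(3) using ab by (intro imageI) simp
    then have "wrap ` {?a..?b} \<inter> C \<noteq> {}" using xy(1) by blast
    moreover have "?a \<le> ?b" "?b \<le> ?a + 1" using ab by linarith+
    ultimately have "C \<subseteq> wrap ` {?a..?b}"
      by (intro connected_subset_arc C)
    then have "x \<in> wrap ` {?a..?b}" "y \<in> wrap ` {?a..?b}" using xy by blast+
    then obtain u v where uv: "x = wrap u" "y = wrap v" "u \<in> {?a..?b}" "v \<in> {?a..?b}"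
      by blast
    then have "\<bar>u - v\<bar> \<le> r"
      using ab(3) m(2) unfolding atLeastAtMost_iff by linarith
    then show "d x y \<le> \<epsilon>" unfolding uv(1,2) by (intro less_imp_le[OF r(2)])
  qed (simp add: F_def)
qed

lemma mdiam_le:
  assumes "A \<noteq> {}" "\<And>x y. x \<in> A \<Longrightarrow> y \<in> A \<Longrightarrow> d x y \<le> c"
  shows "mdiam d A \<le> c"
  unfolding mdiam_def using assms by (intro cSUP_least) auto

end

section \<open>Return times of short arcs\<close>

text \<open>
  Translating a separated set by each of \<open>0, \<dots>, L - 1\<close> gives disjoint copies of it, all inside
  an interval of length \<open>n + L\<close>.
\<close>
lemma card_separated_le:
  fixes A :: "nat set"
  assumes "A \<subseteq> {..<n}" and sep: "\<And>a b. a \<in> A \<Longrightarrow> b \<in> A \<Longrightarrow> a < b \<Longrightarrow> L \<le> b - a"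
  shows "card A * L \<le> n + L"
proof -
  have "inj_on (\<lambda>(a, j). a + j) (A \<times> {..<L})"
  proof (rule inj_onI, clarify)
    fix a i b j assume "a \<in> A" "b \<in> A" "i < L" "j < L" "a + i = b + j"
    then show "a = b \<and> i = j" using sep[of a b] sep[of b a] by (cases a b rule: linorder_cases) auto
  qed
  moreover have "(\<lambda>(a, j). a + j) ` (A \<times> {..<L}) \<subseteq> {..<n + L}"
    using assms(1) by fastforce
  ultimately have "card (A \<times> {..<L}) \<le> card {..<n + L}"
    by (intro card_inj_on_le) auto
  then show ?thesis by (simp add: card_cartesian_product)
qed

locale aperiodic_circle_map = circle_metric +
  fixes T :: "complex \<Rightarrow> complex"
  assumes T_cont: "continuous_on circle T"
    and T_circle: "T ` circle \<subseteq> circle"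
    and T_inj: "inj_on T circle"
    and T_aperiodic: "\<And>x. x \<in> circle \<Longrightarrow> \<not> periodic_point T x"
begin

lemma iterate_in_circle: "x \<in> circle \<Longrightarrow> (T ^^ k) x \<in> circle"
proof (induction k)
  case (Suc k)
  then show ?case using T_circle by (metis comp_apply funpow.simps(2) image_subset_iff)
qed simp

lemma iterate_cont: "continuous_on circle (T ^^ k)"
proof (induction k)
  case (Suc k)
  have "continuous_on ((T ^^ k) ` circle) T"
    using iterate_in_circle by (intro continuous_on_subset[OF T_cont]) auto
  with Suc show ?case unfolding funpow.simps by (rule continuous_on_compose)
qed simp

lemma iterate_inj: "inj_on (T ^^ k) circle"
proof (induction k)
  case (Suc k)
  have "inj_on T ((T ^^ k) ` circle)"
    using iterate_in_circle by (intro inj_on_subset[OF T_inj]) auto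
  with Suc show ?case unfolding funpow.simps by (rule comp_inj_on)
qed simp

lemma iterates_displace:
  obtains c where "c > 0" "\<And>x j. x \<in> circle \<Longrightarrow> 0 < j \<Longrightarrow> j < L \<Longrightarrow> c \<le> d ((T ^^ j) x) x"
proof -
  have "\<exists>c>0. \<forall>x\<in>circle. c \<le> d ((T ^^ j) x) x" if "j > 0" for j
  proof -
    have "continuous_on circle (\<lambda>x. d ((T ^^ j) x) x)"
      using iterate_in_circle by (intro continuous_on_d iterate_cont continuous_intros) auto
    moreover have "circle \<noteq> {}" by (auto intro: exI[of _ 1])
    ultimately obtain z where z: "z \<in> circle"
      "\<And>x. x \<in> circle \<Longrightarrow> d ((T ^^ j) z) z \<le> d ((T ^^ j) x) x"
      using continuous_attains_inf[of circle "\<lambda>x. d ((T ^^ j) x) x"] by auto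
    have "(T ^^ j) z \<noteq> z"
      using T_aperiodic[OF z(1)] that unfolding periodic_point_def by (metis Suc_leI One_nat_def)
    then show ?thesis
      using z iterate_in_circle mdist_pos_less by blast
  qed
  then obtain c where c: "\<And>j. j > 0 \<Longrightarrow> c j > 0"
    "\<And>j x. j > 0 \<Longrightarrow> x \<in> circle \<Longrightarrow> c j \<le> d ((T ^^ j) x) x"
    by metis
  show ?thesis
  proof (rule that[of "Min (insert 1 (c ` {0<..<L}))"])
    show "Min (insert 1 (c ` {0<..<L})) > 0" using c(1) by auto
    fix x j assume "x \<in> circle" "0 < j" "j < L"
    then show "Min (insert 1 (c ` {0<..<L})) \<le> d ((T ^^ j) x) x"
      by (intro order_trans[OF Min_le c(2)]) auto
  qed
qed

text \<open>
  If \<open>p\<close> lies in both images then, cancelling the injective \<open>T ^^ i\<close>, the iterate \<open>T ^^ (k - i)\<close> maps a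
  point of the arc into the arc and so moves it by less than the diameter of the arc.  An arc
  of diameter below the displacement of the first iterates excludes this for \<open>k - i < L\<close>.
\<close>
lemma visits_separated:
  obtains r where "r > 0"
    "\<And>t p i k. \<lbrakk>p \<in> (T ^^ i) ` arc_around t r; p \<in> (T ^^ k) ` arc_around t r; i < k\<rbrakk>
       \<Longrightarrow> L \<le> k - i"
proof -
  obtain c where c: "c > 0"
    "\<And>x j. x \<in> circle \<Longrightarrow> 0 < j \<Longrightarrow> j < L \<Longrightarrow> c \<le> d ((T ^^ j) x) x"
    using iterates_displace by metis
  obtain r where r: "r > 0" "\<And>s t. \<bar>s - t\<bar> \<le> r \<Longrightarrow> d (wrap s) (wrap t) < c"
    using wrap_uniformly_continuous[OF c(1)] by metis
  show ?thesis
  proof (rule that[of "r / 2"])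
    fix t p i k
    assume p: "p \<in> (T ^^ i) ` arc_around t (r / 2)" "p \<in> (T ^^ k) ` arc_around t (r / 2)"
      and ik: "i < k"
    obtain u where u: "p = (T ^^ i) (wrap u)" "u \<in> {t - r / 2..t + r / 2}"
      using p(1) by blast
    obtain v where v: "p = (T ^^ k) (wrap v)" "v \<in> {t - r / 2..t + r / 2}"
      using p(2) by blast
    have "(T ^^ i) ((T ^^ (k - i)) (wrap v)) = (T ^^ (i + (k - i))) (wrap v)"
      by (simp only: funpow_add comp_apply)
    also have "\<dots> = (T ^^ i) (wrap u)"
      using ik u v by simp
    finally have "(T ^^ (k - i)) (wrap v) = wrap u"
      by (rule inj_onD[OF iterate_inj]) (simp_all add: iterate_in_circle[unfolded mem_sphere_0])
    moreover have "d (wrap u) (wrap v) < c" using u v by (intro r(2)) auto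
    ultimately show "L \<le> k - i"
      using c(2)[of "wrap v" "k - i"] ik by (cases "k - i < L") auto
  qed (use r in auto)
qed

section \<open>Averaging the diameters\<close>

theorem diam_mean_equicontinuous: "diam_mean_equicontinuous circle d T"
  unfolding diam_mean_equicontinuous_def
proof (intro allI impI)
  fix \<epsilon> :: real assume eps: "\<epsilon> > 0"
  obtain M where M: "M > 0" "\<And>x y. x \<in> circle \<Longrightarrow> y \<in> circle \<Longrightarrow> d x y \<le> M"
    using d_bounded by metis
  obtain F where F: "finite F"
    "\<And>C x y. \<lbrakk>connected C; C \<subseteq> circle; C \<inter> F = {}; x \<in> C; y \<in> C\<rbrakk> \<Longrightarrow> d x y \<le> \<epsilon> / 2"
    using fine_cut[of "\<epsilon> / 2"] eps by (metis half_gt_zero)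
  \<comment> \<open>For \<open>n \<ge> L\<close> each point of \<open>F\<close> accounts for at most \<open>n / L + 1 \<le> 2 * n / L\<close> times before \<open>n\<close>,
    each contributing at most \<open>M\<close>; the choice of \<open>L\<close> keeps the total below \<open>n * \<epsilon> / 4\<close>.\<close>
  obtain L :: nat where "8 * M * card F / \<epsilon> < L"
    using reals_Archimedean2 by blast
  moreover have "0 \<le> 8 * M * card F / \<epsilon>" using M eps by simp
  ultimately have L: "L > 0" "8 * M * card F < \<epsilon> * L"
    using eps by (simp_all only: of_nat_0_less_iff[where 'a = real, symmetric]) (auto simp: field_simps)
  obtain r where r: "r > 0"
    "\<And>t p i k. \<lbrakk>p \<in> (T ^^ i) ` arc_around t r; p \<in> (T ^^ k) ` arc_around t r; i < k\<rbrakk>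
       \<Longrightarrow> L \<le> k - i"
    using visits_separated by metis
  obtain \<delta> where delta: "\<delta> > 0" "\<And>t. mcball (wrap t) \<delta> \<subseteq> arc_around t r"
    using mcball_subset_arc[OF r(1)] by metis
  have "limsup (\<lambda>n. ereal (1 / real n * (\<Sum>k<n. mdiam d ((T ^^ k) ` mcball x \<delta>)))) < ereal \<epsilon>"
    if x: "x \<in> circle" for x
  proof -
    obtain t where t: "x = wrap t" using circle_wrapE[OF x] by metis
    let ?J = "arc_around t r"
    have J: "?J \<subseteq> circle" by auto
    have TJ: "(T ^^ k) ` ?J \<subseteq> circle" for k using iterate_in_circle by auto
    have conn: "connected ((T ^^ k) ` ?J)" for k
      by (intro connected_continuous_image continuous_on_subset[OF iterate_cont J]
          continuous_on_wrap) auto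
    have diam: "mdiam d ((T ^^ k) ` mcball x \<delta>)
        \<le> \<epsilon> / 2 + M * (\<Sum>p\<in>F. of_bool (p \<in> (T ^^ k) ` ?J))" for k
    proof (rule mdiam_le)
      have "x \<in> mcball x \<delta>" using x delta(1) by (simp add: in_mcball)
      then show "(T ^^ k) ` mcball x \<delta> \<noteq> {}" by blast
      fix y z assume "y \<in> (T ^^ k) ` mcball x \<delta>" "z \<in> (T ^^ k) ` mcball x \<delta>"
      then have yz: "y \<in> (T ^^ k) ` ?J" "z \<in> (T ^^ k) ` ?J" using delta(2) t by blast+
      show "d y z \<le> \<epsilon> / 2 + M * (\<Sum>p\<in>F. of_bool (p \<in> (T ^^ k) ` ?J))"
      proof (cases "(T ^^ k) ` ?J \<inter> F = {}")
        case True
        then have "d y z \<le> \<epsilon> / 2" using F(2)[OF conn TJ] yz by blast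
        moreover have "0 \<le> M * (\<Sum>p\<in>F. of_bool (p \<in> (T ^^ k) ` ?J))"
          using M(1) by (intro mult_nonneg_nonneg sum_nonneg) auto
        ultimately show ?thesis by linarith
      next
        case False
        then obtain p where p: "p \<in> F" "p \<in> (T ^^ k) ` ?J" by blast
        then have "(1::real) \<le> (\<Sum>p\<in>F. of_bool (p \<in> (T ^^ k) ` ?J))"
          using F(1) member_le_sum[of p F "\<lambda>p. of_bool (p \<in> (T ^^ k) ` ?J) :: real"] by auto
        then have "M * 1 \<le> M * (\<Sum>p\<in>F. of_bool (p \<in> (T ^^ k) ` ?J))"
          using M(1) by (intro mult_left_mono) auto
        moreover have "d y z \<le> M" using M(2) TJ yz by blast
        ultimately show ?thesis using eps by linarith
      qed
    qed
    have visits: "(\<Sum>k<n. of_bool (p \<in> (T ^^ k) ` ?J)) \<le> (real n + L) / L" for n p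
    proof -
      let ?A = "{k\<in>{..<n}. p \<in> (T ^^ k) ` ?J}"
      have "card ?A * L \<le> n + L"
      proof (rule card_separated_le)
        fix i k assume "i \<in> ?A" "k \<in> ?A" "i < k"
        then show "L \<le> k - i" by (intro r(2)[of p i t k]) simp_all
      qed blast
      then have "real (card ?A) * L \<le> real n + L"
        by (simp only: flip: of_nat_add of_nat_mult of_nat_le_iff[where 'a = real])
      moreover have "(\<Sum>k<n. of_bool (p \<in> (T ^^ k) ` ?J)) = real (card ?A)"
        by (simp add: of_bool_def sum.If_cases Int_def)
      ultimately show ?thesis using L(1) by (simp add: field_simps)
    qed
    have "1 / real n * (\<Sum>k<n. mdiam d ((T ^^ k) ` mcball x \<delta>)) \<le> 3 * \<epsilon> / 4" if n: "n \<ge> L" for n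
    proof -
      have "(\<Sum>k<n. mdiam d ((T ^^ k) ` mcball x \<delta>))
          \<le> (\<Sum>k<n. \<epsilon> / 2 + M * (\<Sum>p\<in>F. of_bool (p \<in> (T ^^ k) ` ?J)))"
        by (intro sum_mono diam)
      also have "\<dots> = n * (\<epsilon> / 2) + M * (\<Sum>k<n. \<Sum>p\<in>F. of_bool (p \<in> (T ^^ k) ` ?J))"
        by (simp only: sum.distrib sum_constant card_lessThan flip: sum_distrib_left)
      also have "(\<Sum>k<n. \<Sum>p\<in>F. of_bool (p \<in> (T ^^ k) ` ?J))
          = (\<Sum>p\<in>F. \<Sum>k<n. of_bool (p \<in> (T ^^ k) ` ?J) :: real)"
        by (rule sum.swap)
      also have "\<dots> \<le> card F * ((real n + L) / L)"
        using sum_bounded_above[of F _ "(real n + L) / L"] visits by simp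
      also have "(real n + L) / L \<le> 2 * n / L"
        using n L(1) by (intro divide_right_mono) auto
      finally have "(\<Sum>k<n. mdiam d ((T ^^ k) ` mcball x \<delta>))
          \<le> n * (\<epsilon> / 2) + M * (card F * (2 * n / L))"
        using M(1) by (simp add: mult_left_mono)
      also have "M * (card F * (2 * n / L)) = n * (8 * M * card F / (4 * L))"
        by simp
      also have "\<dots> \<le> n * (\<epsilon> / 4)"
        using L by (intro mult_left_mono) (auto simp: field_simps)
      finally show ?thesis using n L(1) by (simp add: field_simps)
    qed
    then have "eventually (\<lambda>n. ereal (1 / real n * (\<Sum>k<n. mdiam d ((T ^^ k) ` mcball x \<delta>)))
        \<le> ereal (3 * \<epsilon> / 4)) sequentially"
      by (intro eventually_sequentiallyI[of L]) simp
    then have "limsup (\<lambda>n. ereal (1 / real n * (\<Sum>k<n. mdiam d ((T ^^ k) ` mcball x \<delta>))))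
        \<le> ereal (3 * \<epsilon> / 4)"
      by (rule Limsup_bounded)
    also have "\<dots> < ereal \<epsilon>" using eps by simp
    finally show ?thesis .
  qed
  then show "\<exists>\<delta>>0. \<forall>x\<in>circle.
      limsup (\<lambda>n. ereal (1 / real n * (\<Sum>k<n. mdiam d ((T ^^ k) ` mcball x \<delta>)))) < ereal \<epsilon>"
    using delta(1) by blast
qed

end

theorem proposition1p2:
  fixes T :: "complex \<Rightarrow> complex" and d :: "complex \<Rightarrow> complex \<Rightarrow> real"
  assumes "Denjoy_system T"
    and "Metric_space circle d"
    and "Metric_space.mtopology circle d = top_of_set circle"
  shows "diam_mean_equicontinuous circle d T"
proof -
  have homeo: "homeomorphic_map (top_of_set circle) (top_of_set circle) T"
    and aper: "\<And>x. x \<in> circle \<Longrightarrow> \<not> periodic_point T x"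
    using assms(1) by (auto simp: Denjoy_system_def orientation_preserving_homeo_def)
  interpret Metric_space circle d by (rule assms(2))
  interpret aperiodic_circle_map d T
  proof
    show "mtopology = top_of_set circle" by (rule assms(3))
    show "continuous_on circle T" "T ` circle \<subseteq> circle"
      using homeomorphic_imp_continuous_map[OF homeo]
      by (auto simp: continuous_map_in_subtopology)
    show "inj_on T circle"
      using homeomorphic_imp_injective_map[OF homeo] by simp
  qed (rule aper)
  show ?thesis by (rule diam_mean_equicontinuous)
qed

end
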